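(* Let $X$ be a Banach space, let $Y$ be a closed subspace of $X$, and let $\lambda,\mu\ge 1$. (a) If the pair $(X^* ,Y^\perp)$ has the $\pi_\lambda$-property and the pair $(X,Y)$ has the $\mu$-bounded approximation property, then the pair $(X,Y)$ has the $\pi_{\lambda\mu+\lambda+\mu}$-duality property. (b) If the pair $(X,Y)$ has the $\pi_\lambda$-property and the pair $(X^*, Y^\perp)$ has the $\mu$-bounded approximation property, then the pair $(X,Y)$ has the $\pi_{\lambda\mu+\lambda+\mu}$-duality property.
   Context: $\mathcal{F}(Z)$ denotes the space of bounded finite-rank linear operators on a Banach space $Z$; $Y^\perp=\{x^*\in X^*: x^*(y)=0\ \forall y\in Y\}$. For a Banach space $Z$ and a closed subspace $W$ and $\lambda\ge1$: the pair $(Z,W)$ has the $\lambda$-bounded approximation property if for every finite-dimensional subspace $E$ of $Z$ and every $\varepsilon>0$ there exists $S\in\mathcal{F}(Z)$ with $S(W)\subset W$, $\|S\|\le\lambda+\varepsilon$, and $Sz=z$ for all $z\in E$. The pair $(Z,W)$ has the $\pi_\lambda$-property if for every finite-dimensional subspace $E$ of $Z$ and every $\varepsilon>0$ there exists a projection $P\in\mathcal{F}(Z)$ with $P(W)\subset W$, $\|P\|\le\lambda+\varepsilon$, and $Pz=z$ for all $z\in E$. The pair $(Z,W)$ has the $\pi_\lambda$-duality property if for all finite-dimensional subspaces $E$ of $Z$ and $F$ of $Z^*$ and every $\varepsilon>0$ there exists a projection $P\in\mathcal{F}(Z)$ with $P(W)\subset W$, $\|P\|\le\lambda+\varepsilon$,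 $Pz=z$ for all $z\in E$, and $P^*z^*=z^*$ for all $z^*\in F$. *)

theory Defs
  imports "HOL-Analysis.Analysis"
begin

definition fin_dim_subspace :: "'z::real_normed_vector set \<Rightarrow> bool" where
  "fin_dim_subspace E \<longleftrightarrow> (\<exists>B. finite B \<and> E = span B)"

definition finite_rank :: "('z::real_normed_vector \<Rightarrow>\<^sub>L 'z) \<Rightarrow> bool" where
  "finite_rank S \<longleftrightarrow> (\<exists>B. finite B \<and> range (blinfun_apply S) \<subseteq> span B)"

definition annihilator :: "'a::real_normed_vector set \<Rightarrow> ('a \<Rightarrow>\<^sub>L real) set" where
  "annihilator Y = {f. \<forall>y\<in>Y. blinfun_apply f y = 0}"

text \<open>The pair (Z,W) (Z the ambient type) has the lambda-bounded approximation property.\<close>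
definition pair_bap :: "real \<Rightarrow> 'z::real_normed_vector set \<Rightarrow> bool" where
  "pair_bap lam W \<longleftrightarrow>
     (\<forall>E. fin_dim_subspace E \<longrightarrow> (\<forall>\<epsilon>>0. \<exists>S::'z \<Rightarrow>\<^sub>L 'z.
        finite_rank S \<and> blinfun_apply S ` W \<subseteq> W \<and> norm S \<le> lam + \<epsilon> \<and> (\<forall>z\<in>E. S z = z)))"

definition pair_pi :: "real \<Rightarrow> 'z::real_normed_vector set \<Rightarrow> bool" where
  "pair_pi lam W \<longleftrightarrow>
     (\<forall>E. fin_dim_subspace E \<longrightarrow> (\<forall>\<epsilon>>0. \<exists>P::'z \<Rightarrow>\<^sub>L 'z.
        finite_rank P \<and> P o\<^sub>L P = P \<and> blinfun_apply P ` W \<subseteq> W \<and> norm P \<le> lam + \<epsilon>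
        \<and> (\<forall>z\<in>E. P z = z)))"

text \<open>The pair (Z,W) has the pi-lambda duality property; the adjoint condition
  P* f = f is written out as f o P = f.\<close>
definition pair_pi_duality :: "real \<Rightarrow> 'z::real_normed_vector set \<Rightarrow> bool" where
  "pair_pi_duality lam W \<longleftrightarrow>
     (\<forall>E F. fin_dim_subspace E \<longrightarrow> fin_dim_subspace (F :: ('z \<Rightarrow>\<^sub>L real) set) \<longrightarrow>
       (\<forall>\<epsilon>>0. \<exists>P::'z \<Rightarrow>\<^sub>L 'z.
        finite_rank P \<and> P o\<^sub>L P = P \<and> blinfun_apply P ` W \<subseteq> W \<and> norm P \<le> lam + \<epsilon>
        \<and> (\<forall>z\<in>E. P z = z) \<and> (\<forall>f\<in>F. f o\<^sub>L P = f)))"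

end

theory Submission
  imports Defs
begin

text \<open>If \<open>A\<close>, \<open>B\<close> are finite-rank operators on \<open>X\<close> preserving \<open>Y\<close> such that \<open>B\<close> fixes \<open>E\<close> and the
  adjoint of \<open>A\<close> fixes \<open>F\<close>, then \<open>P\<close> given by \<open>I - P = (I - A) (I - B)\<close> does both. It is a
  projection as soon as \<open>A\<close> is a projection with \<open>B A = B\<close>, or \<open>B\<close> is a projection with \<open>B A = A\<close>,
  which one gets by choosing the projection last and letting it (or its adjoint) fix the range of
  the other operator (or of its adjoint).

  The hypothesis on the dual space provides an operator \<open>S\<close> on the dual, which has to be replaced
  by an adjoint. This is a local reflexivity statement for pairs: if \<open>S\<close> has finite rank, preserves
  the annihilator of \<open>Y\<close> and fixes a finite set \<open>C\<close>, then there is an operator \<open>T\<close> on \<open>X\<close> preserving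
  \<open>Y\<close>, of norm at most \<open>\<parallel>S\<parallel> + e\<close>, whose adjoint maps into the range of \<open>S\<close> and fixes \<open>C\<close>.
  Choose a biorthogonal system \<open>(r\<^sub>i, x\<^sub>i)\<close> for the range of \<open>S\<close> with \<open>r\<^sub>i\<close> annihilating \<open>Y\<close> or
  \<open>x\<^sub>i \<in> Y\<close>. The operator \<open>\<Sum>r\<^sub>i \<otimes> x\<^sub>i\<close> has all the required properties except for the norm bound. By
  the Hahn-Banach theorem, its distance to the space of admissible corrections is the value of a
  functional \<open>T \<mapsto> \<Sum>f\<^sub>l (T w\<^sub>l)\<close> with \<open>w\<^sub>l\<close> in the unit ball and \<open>\<Sum>\<parallel>f\<^sub>l\<parallel> \<le> 1\<close>, up to a factor
  close to 1, and this value turns out to be \<open>\<Sum>(S f\<^sub>l) w\<^sub>l \<le> \<parallel>S\<parallel>\<close>.\<close>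

section \<open>The Hahn-Banach theorem\<close>

definition sublinear :: "('b::real_vector \<Rightarrow> real) \<Rightarrow> bool" where
  "sublinear p \<longleftrightarrow> (\<forall>x y. p (x + y) \<le> p x + p y) \<and> (\<forall>t>0. \<forall>x. p (t *\<^sub>R x) = t * p x)"

lemma sublinear_add: "sublinear p \<Longrightarrow> p (x + y) \<le> p x + p y"
  and sublinear_scaleR: "sublinear p \<Longrightarrow> t > 0 \<Longrightarrow> p (t *\<^sub>R x) = t * p x"
  by (auto simp: sublinear_def)

lemma sublinear_zero: "sublinear p \<Longrightarrow> p 0 = 0"
  using sublinear_scaleR[of p 2 0] by simp

lemma sublinear_ge_minus: "sublinear p \<Longrightarrow> - p (- x) \<le> p x"
  using sublinear_add[of p x "- x"] sublinear_zero[of p] by simp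

lemma sublinear_scaleR_nonneg: "sublinear p \<Longrightarrow> t \<ge> 0 \<Longrightarrow> p (t *\<^sub>R x) = t * p x"
  using sublinear_scaleR sublinear_zero by (cases "t = 0") auto

text \<open>Only one inequality of homogeneity has to be checked: applied to
  \<open>inverse t\<close> and \<open>t *\<^sub>R x\<close> it yields the other.\<close>

lemma sublinearI:
  assumes "\<And>x y. p (x + y) \<le> p x + p y" and le: "\<And>t x. t > 0 \<Longrightarrow> p (t *\<^sub>R x) \<le> t * p x"
  shows "sublinear p"
proof -
  have "p (t *\<^sub>R x) = t * p x" if "t > 0" for t x
    using le[of t x] le[of "inverse t" "t *\<^sub>R x"] that by (simp add: field_simps)
  then show ?thesis
    using assms(1) by (simp add: sublinear_def)
qed

text \<open>Take \<open>q x\<close> as the infimum of \<open>p (x + t *\<^sub>R a) - t * p a\<close>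
  over \<open>t \<ge> 0\<close>. The choice \<open>t = 0\<close> gives \<open>q x \<le> p x\<close>,
  the choice \<open>t = 1\<close> at \<open>- a\<close> the last estimate; by subadditivity
  \<open>- p (- x)\<close> is a lower bound, so the infimum is finite.\<close>

lemma sublinear_lower:
  assumes p: "sublinear p"
  obtains q where "sublinear q" "\<And>x. q x \<le> p x" "q (- a) \<le> - p a"
proof -
  define S where "S x = (\<lambda>t. p (x + t *\<^sub>R a) - t * p a) ` {0..}" for x
  define q where "q x = Inf (S x)" for x
  have lb: "- p (- x) \<le> s" if "s \<in> S x" for s x
  proof -
    obtain t where t: "t \<ge> 0" "s = p (x + t *\<^sub>R a) - t * p a"
      using \<open>s \<in> S x\<close> by (auto simp: S_def)
    have "t * p a = p (t *\<^sub>R a)"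
      using p t by (simp add: sublinear_scaleR_nonneg)
    also have "\<dots> \<le> p (x + t *\<^sub>R a) + p (- x)"
      using sublinear_add[OF p, of "x + t *\<^sub>R a" "- x"] by simp
    finally show ?thesis
      using t by simp
  qed
  then have bdd: "bdd_below (S x)" for x
    by (meson bdd_belowI)
  have ne: "S x \<noteq> {}" for x
    by (auto simp: S_def)
  have q_le: "q x \<le> p (x + t *\<^sub>R a) - t * p a" if "t \<ge> 0" for x t
    unfolding q_def using that by (intro cInf_lower bdd) (auto simp: S_def)
  have q_ge: "c \<le> q x" if "\<And>t. t \<ge> 0 \<Longrightarrow> c \<le> p (x + t *\<^sub>R a) - t * p a" for c x
    unfolding q_def using that by (intro cInf_greatest ne) (auto simp: S_def)
  have "sublinear q"
  proof (rule sublinearI)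
    fix x y
    have *: "q (x + y) \<le> (p (x + s *\<^sub>R a) - s * p a) + (p (y + t *\<^sub>R a) - t * p a)"
      if "s \<ge> 0" "t \<ge> 0" for s t
      using q_le[of "s + t" "x + y"] that
        sublinear_add[OF p, of "x + s *\<^sub>R a" "y + t *\<^sub>R a"]
      by (simp add: algebra_simps)
    have "q (x + y) - (p (x + s *\<^sub>R a) - s * p a) \<le> q y" if "s \<ge> 0" for s
      using *[OF that] by (intro q_ge) (simp add: algebra_simps)
    then have "q (x + y) - q y \<le> q x"
      by (intro q_ge) (simp add: algebra_simps)
    then show "q (x + y) \<le> q x + q y"
      by simp
  next
    fix t :: real and x
    assume t: "t > 0"
    have "q (t *\<^sub>R x) / t \<le> q x"
    proof (rule q_ge)
      fix s :: real
      assume "s \<ge> 0"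
      then have "q (t *\<^sub>R x) \<le> p (t *\<^sub>R (x + s *\<^sub>R a)) - (t * s) * p a"
        using q_le[of "t * s" "t *\<^sub>R x"] t by (simp add: algebra_simps)
      also have "\<dots> = t * (p (x + s *\<^sub>R a) - s * p a)"
        unfolding sublinear_scaleR[OF p t] by (simp add: algebra_simps)
      finally show "q (t *\<^sub>R x) / t \<le> p (x + s *\<^sub>R a) - s * p a"
        using t by (simp add: field_simps)
    qed
    then show "q (t *\<^sub>R x) \<le> t * q x"
      using t by (simp add: field_simps)
  qed
  moreover have "q x \<le> p x" for x
    using q_le[of 0 x] by simp
  moreover have "q (- a) \<le> - p a"
    using q_le[of 1 "- a"] p by (simp add: sublinear_zero)
  ultimately show thesis
    by (rule that)
qed

text \<open>Zorn's lemma applies because the pointwise infimum of a chain is sublinear: any two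
  members have a common lower one, and \<open>- p (- x)\<close> bounds all of them below.\<close>

lemma ex_minimal_sublinear:
  assumes p: "sublinear p"
  obtains q where "sublinear q" "q \<le> p" "\<And>r. sublinear r \<Longrightarrow> r \<le> q \<Longrightarrow> r = q"
proof -
  define A where "A = {q. sublinear q \<and> q \<le> p}"
  \<comment> \<open>The order is reversed, so the maximal element from \<open>predicate_Zorn\<close>
    is a minimal functional.\<close>
  define R where "R = (\<lambda>q r :: 'a \<Rightarrow> real. r \<le> q)"
  have "\<exists>m\<in>A. \<forall>a\<in>A. R m a \<longrightarrow> a = m"
  proof (rule predicate_Zorn)
    show "partial_order_on A (relation_of R A)"
      by (auto simp: R_def partial_order_on_def preorder_on_def refl_on_def trans_def
          antisym_def relation_of_def; meson order_trans order_antisym)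
  next
    fix C
    assume C: "C \<in> Chains (relation_of R A)"
    show "\<exists>u\<in>A. \<forall>a\<in>C. R a u"
    proof (cases "C = {}")
      case True
      then show ?thesis
        using p by (auto simp: A_def)
    next
      case ne: False
      have CA: "sublinear q" "q \<le> p" if "q \<in> C" for q
        using C that by (auto simp: Chains_def relation_of_def A_def)
      have tot: "q \<le> r \<or> r \<le> q" if "q \<in> C" "r \<in> C" for q r
        using C that by (auto simp: Chains_def relation_of_def R_def)
      define u where "u x = (INF q\<in>C. q x)" for x
      have "- p (- x) \<le> q x" if "q \<in> C" for q x
        using sublinear_ge_minus[OF CA(1)[OF that], of x] CA(2)[OF that, THEN le_funD, of "- x"]
        by linarith
      then have bdd: "bdd_below ((\<lambda>q. q x) ` C)" for x
        by (intro bdd_belowI2)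
      have u_le: "u x \<le> q x" if "q \<in> C" for q x
        unfolding u_def using bdd that by (rule cINF_lower)
      have u_ge: "c \<le> u x" if "\<And>q. q \<in> C \<Longrightarrow> c \<le> q x" for c x
        unfolding u_def using ne that by (rule cINF_greatest)
      have "sublinear u"
      proof (rule sublinearI)
        fix x y
        have *: "u (x + y) \<le> q x + r y" if qr: "q \<in> C" "r \<in> C" for q r
        proof -
          obtain s where s: "s \<in> C" "s \<le> q" "s \<le> r"
            using tot[OF qr] qr by blast
          have "u (x + y) \<le> s (x + y)"
            using s by (intro u_le)
          also have "\<dots> \<le> s x + s y"
            using s CA by (intro sublinear_add)
          also have "\<dots> \<le> q x + r y"
            using le_funD[OF s(2), of x] le_funD[OF s(3), of y] by linarith
          finally show ?thesis .
        qed
        have "u (x + y) - q x \<le> u y" if "q \<in> C" for q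
          using *[OF that] by (intro u_ge) (simp add: algebra_simps)
        then have "u (x + y) - u y \<le> u x"
          by (intro u_ge) (simp add: algebra_simps)
        then show "u (x + y) \<le> u x + u y"
          by simp
      next
        fix t :: real and x
        assume t: "t > 0"
        have "u (t *\<^sub>R x) / t \<le> u x"
        proof (rule u_ge)
          fix q
          assume q: "q \<in> C"
          show "u (t *\<^sub>R x) / t \<le> q x"
            using u_le[OF q, of "t *\<^sub>R x"] sublinear_scaleR[OF CA(1)[OF q] t] t
            by (simp add: field_simps)
        qed
        then show "u (t *\<^sub>R x) \<le> t * u x"
          using t by (simp add: field_simps)
      qed
      moreover have "u \<le> p"
      proof (rule le_funI)
        fix x
        obtain q where q: "q \<in> C"
          using ne by blast
        show "u x \<le> p x"
          using u_le[OF q, of x] le_funD[OF CA(2)[OF q], of x] by linarith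
      qed
      ultimately show ?thesis
        using u_le by (auto simp: A_def R_def le_fun_def)
    qed
  qed
  then obtain m where m: "m \<in> A" "\<And>a. a \<in> A \<Longrightarrow> a \<le> m \<Longrightarrow> a = m"
    by (auto simp: R_def)
  show thesis
  proof (rule that)
    show "sublinear m" "m \<le> p"
      using m(1) by (auto simp: A_def)
    show "r = m" if "sublinear r" "r \<le> m" for r
      using that order_trans[OF that(2) \<open>m \<le> p\<close>] by (intro m(2)) (auto simp: A_def)
  qed
qed

text \<open>A minimal sublinear functional \<open>q\<close> coincides with its lowering at any \<open>a\<close>, which
  gives \<open>q (- a) = - q a\<close>, hence linearity.\<close>
theorem Hahn_Banach_sublinear:
  assumes p: "sublinear p"
  obtains f where "linear f" "\<And>x. f x \<le> p x" "f v = p v"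
proof -
  \<comment> \<open>Lowering at \<open>v\<close> first secures the value at \<open>v\<close>: once
    \<open>f\<close> is odd, \<open>f v = - f (- v) \<ge> - p' (- v) \<ge> p v\<close>.\<close>
  obtain p' where p': "sublinear p'" "\<And>x. p' x \<le> p x" "p' (- v) \<le> - p v"
    using sublinear_lower[OF p] by metis
  obtain f where f: "sublinear f" "f \<le> p'" "\<And>r. sublinear r \<Longrightarrow> r \<le> f \<Longrightarrow> r = f"
    using ex_minimal_sublinear[OF p'(1)] by metis
  have neg: "f (- x) = - f x" for x
  proof -
    obtain r where r: "sublinear r" "\<And>y. r y \<le> f y" "r (- x) \<le> - f x"
      using sublinear_lower[OF f(1)] by metis
    have "r = f"
      using r by (intro f(3)) (auto simp: le_fun_def)
    then show ?thesis
      using r(3) sublinear_ge_minus[OF f(1), of "x"] by simp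
  qed
  have "linear f"
  proof (rule linearI)
    fix x y
    show "f (x + y) = f x + f y"
      using sublinear_add[OF f(1), of x y] sublinear_add[OF f(1), of "- x" "- y"]
        neg[of x] neg[of y] neg[of "x + y"] by simp
  next
    fix t x
    show "f (t *\<^sub>R x) = t *\<^sub>R f x"
    proof (cases "t \<ge> 0")
      case True
      then show ?thesis
        using f(1) by (simp add: sublinear_scaleR_nonneg)
    next
      case False
      then have "f ((- t) *\<^sub>R (- x)) = (- t) * f (- x)"
        using f(1) by (intro sublinear_scaleR_nonneg) auto
      then show ?thesis
        by (simp add: neg)
    qed
  qed
  moreover have f_le: "f x \<le> p x" for x
    using p'(2)[of x] le_funD[OF f(2), of x] by linarith
  moreover have "f v = p v"
    using f_le[of v] neg[of v] p'(3) le_funD[OF f(2), of "- v"] by linarith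
  ultimately show thesis
    by (rule that)
qed

lemma sublinear_infdist:
  fixes M :: "'b::real_normed_vector set"
  assumes M: "subspace M"
  shows "sublinear (\<lambda>x. infdist x M)"
proof -
  have ne: "M \<noteq> {}"
    using subspace_0[OF M] by auto
  have ge: "c \<le> infdist x M" if "\<And>m. m \<in> M \<Longrightarrow> c \<le> dist x m" for c x
    unfolding infdist_notempty[OF ne] using ne that by (rule cINF_greatest)
  show ?thesis
  proof (rule sublinearI)
    fix x y
    have *: "infdist (x + y) M \<le> dist x m + dist y n" if "m \<in> M" "n \<in> M" for m n
      using infdist_le[OF subspace_add[OF M that], of "x + y"] dist_triangle_add[of x y m n]
      by linarith
    have "infdist (x + y) M - dist x m \<le> infdist y M" if "m \<in> M" for m
      using *[OF that] by (intro ge) (simp add: algebra_simps)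
    then have "infdist (x + y) M - infdist y M \<le> infdist x M"
      by (intro ge) (simp add: algebra_simps)
    then show "infdist (x + y) M \<le> infdist x M + infdist y M"
      by simp
  next
    fix t :: real and x
    assume t: "t > 0"
    have "infdist (t *\<^sub>R x) M / t \<le> infdist x M"
    proof (rule ge)
      fix m
      assume "m \<in> M"
      then have "infdist (t *\<^sub>R x) M \<le> dist (t *\<^sub>R x) (t *\<^sub>R m)"
        by (intro infdist_le subspace_scale M)
      also have "\<dots> = t * dist x m"
        using t by (simp add: dist_norm flip: scaleR_diff_right)
      finally show "infdist (t *\<^sub>R x) M / t \<le> dist x m"
        using t by (simp add: field_simps)
    qed
    then show "infdist (t *\<^sub>R x) M \<le> t * infdist x M"
      using t by (simp add: field_simps)
  qed
qed

text \<open>Domination by \<open>infdist x M\<close> serves twice: it is at most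
  \<open>norm x\<close> since \<open>0 \<in> M\<close>, and it vanishes on \<open>M\<close>, which
  makes both \<open>f m\<close> and \<open>f (- m)\<close> nonpositive.\<close>

theorem Hahn_Banach_infdist:
  fixes M :: "'b::real_normed_vector set"
  assumes M: "subspace M"
  obtains f :: "'b \<Rightarrow>\<^sub>L real"
  where "norm f \<le> 1" "\<And>m. m \<in> M \<Longrightarrow> f m = 0" "f v = infdist v M"
proof -
  obtain f where f: "linear f" "\<And>x. f x \<le> infdist x M" "f v = infdist v M"
    using Hahn_Banach_sublinear[OF sublinear_infdist[OF M]] by metis
  have le: "f x \<le> norm x" for x
    using f(2)[of x] infdist_le[OF subspace_0[OF M], of x] by simp
  have abs: "\<bar>f x\<bar> \<le> norm x" for x
    using le[of x] le[of "- x"] linear_neg[OF f(1), of x] by simp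
  have bl: "bounded_linear f"
    using f(1) abs by (intro bounded_linear_intro[of _ 1])
      (auto simp: linear_add linear_scale)
  have "f m = 0" if m: "m \<in> M" for m
    using f(2)[of m] f(2)[of "- m"] m subspace_neg[OF M m] linear_neg[OF f(1), of m] by simp
  moreover have "norm (Blinfun f) \<le> 1"
    using abs by (intro norm_blinfun_bound) (auto simp: bounded_linear_Blinfun_apply[OF bl])
  ultimately show thesis
    using f(3) by (intro that[of "Blinfun f"]) (auto simp: bounded_linear_Blinfun_apply[OF bl])
qed

lemma ex_blinfun_apply_nonzero:
  fixes x :: "'b::real_normed_vector"
  assumes "x \<noteq> 0"
  shows "\<exists>f :: 'b \<Rightarrow>\<^sub>L real. f x \<noteq> 0"
proof -
  obtain f :: "'b \<Rightarrow>\<^sub>L real" where "f x = infdist x {0}"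
    using Hahn_Banach_infdist[OF subspace_single_0] by metis
  then show ?thesis
    using assms by (intro exI[of _ f]) simp
qed

section \<open>Adapted biorthogonal systems\<close>

text \<open>Each pair is its own index. The form \<open>b\<close> stays abstract because the duality
  pairing is used in both orders: functionals first for local reflexivity, vectors first in
  \<open>finite_rank_adjoint\<close>.\<close>

definition biorthogonal :: "('u::real_vector \<Rightarrow> 'v::real_vector \<Rightarrow> real) \<Rightarrow> ('u \<times> 'v) set \<Rightarrow> bool" where
  "biorthogonal b P \<longleftrightarrow> finite P \<and> (\<forall>p\<in>P. \<forall>q\<in>P. b (fst p) (snd q) = (if p = q then 1 else 0))"

lemma biorthogonal_finite: "biorthogonal b P \<Longrightarrow> finite P"
  by (simp add: biorthogonal_def)

lemma biorthogonal_apply: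
  "biorthogonal b P \<Longrightarrow> p \<in> P \<Longrightarrow> q \<in> P \<Longrightarrow> b (fst p) (snd q) = (if p = q then 1 else 0)"
  by (auto simp: biorthogonal_def)

lemma biorthogonal_sum_right:
  assumes bil: "bilinear b" and P: "biorthogonal b P" and q: "q \<in> P"
  shows "b (fst q) (\<Sum>p\<in>P. c p *\<^sub>R snd p) = c q"
proof -
  have lin: "linear (b (fst q))"
    using bil by (simp add: bilinear_def)
  have "b (fst q) (\<Sum>p\<in>P. c p *\<^sub>R snd p) = (\<Sum>p\<in>P. c p * b (fst q) (snd p))"
    by (simp add: linear_sum[OF lin] linear_scale[OF lin])
  also have "\<dots> = (\<Sum>p\<in>P. if p = q then c q else 0)"
    using biorthogonal_apply[OF P q] by (intro sum.cong) auto
  finally show ?thesis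
    using q biorthogonal_finite[OF P] by simp
qed

lemma biorthogonal_sum_left:
  assumes bil: "bilinear b" and P: "biorthogonal b P" and q: "q \<in> P"
  shows "b (\<Sum>p\<in>P. c p *\<^sub>R fst p) (snd q) = c q"
proof -
  have lin: "linear (\<lambda>u. b u (snd q))"
    using bil by (simp add: bilinear_def)
  have "b (\<Sum>p\<in>P. c p *\<^sub>R fst p) (snd q) = (\<Sum>p\<in>P. c p * b (fst p) (snd q))"
    by (simp add: linear_sum[OF lin] linear_scale[OF lin])
  also have "\<dots> = (\<Sum>p\<in>P. if p = q then c q else 0)"
    using biorthogonal_apply[OF P _ q] by (intro sum.cong) auto
  finally show ?thesis
    using q biorthogonal_finite[OF P] by simp
qed

lemma biorthogonal_expansion:
  assumes bil: "bilinear b" and P: "biorthogonal b P" and u: "u \<in> span (fst ` P)"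
  shows "u = (\<Sum>p\<in>P. b u (snd p) *\<^sub>R fst p)"
  using u
proof (induction rule: span_induct)
  case base
  have lin: "linear (\<lambda>u. b u v)" for v
    using bil by (simp add: bilinear_def)
  have scale: "c *\<^sub>R u = (\<Sum>p\<in>P. (c * b u (snd p)) *\<^sub>R fst p)"
    if "u = (\<Sum>p\<in>P. b u (snd p) *\<^sub>R fst p)" for c u
    by (subst that) (simp add: scaleR_sum_right)
  show ?case
  proof (rule subspaceI)
    fix c u
    assume "u \<in> {u. u = (\<Sum>p\<in>P. b u (snd p) *\<^sub>R fst p)}"
    then have "c *\<^sub>R u = (\<Sum>p\<in>P. (c * b u (snd p)) *\<^sub>R fst p)"
      by (intro scale) simp
    then show "c *\<^sub>R u \<in> {u. u = (\<Sum>p\<in>P. b u (snd p) *\<^sub>R fst p)}"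
      unfolding mem_Collect_eq linear_scale[OF lin] real_scaleR_def .
  qed (auto simp: linear_0[OF lin] linear_add[OF lin] scaleR_left_distrib sum.distrib)
next
  case (step u)
  then obtain q where q: "q \<in> P" "u = fst q"
    by auto
  have "(\<Sum>p\<in>P. b u (snd p) *\<^sub>R fst p) = (\<Sum>p\<in>P. if p = q then fst q else 0)"
    using q biorthogonal_apply[OF P q(1)] by (intro sum.cong) auto
  then show ?case
    using q biorthogonal_finite[OF P] by simp
qed

text \<open>Every summand lies in \<open>Y\<close>: either its coefficient is zero or its vector is
  in \<open>Y\<close>.\<close>

lemma biorthogonal_remainder_in_subspace:
  assumes Y: "subspace Y" and y: "y \<in> Y"
    and adapted: "\<And>p. p \<in> P \<Longrightarrow> (\<forall>y\<in>Y. b (fst p) y = 0) \<or> snd p \<in> Y"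
  shows "y - (\<Sum>p\<in>P. b (fst p) y *\<^sub>R snd p) \<in> Y"
proof (intro subspace_diff[OF Y] y subspace_sum[OF Y])
  fix p
  assume "p \<in> P"
  then show "b (fst p) y *\<^sub>R snd p \<in> Y"
    using adapted[of p] y by (auto simp: subspace_0[OF Y] subspace_scale[OF Y])
qed

text \<open>A Gram-Schmidt induction that leaves the earlier pairs unchanged: \<open>u\<close> is
  made orthogonal to the earlier second components, and its partner to the earlier first ones. The
  latter correction does not leave \<open>Y\<close>, because the earlier pairs are adapted.\<close>

lemma ex_adapted_biorthogonal:
  assumes bil: "bilinear b" and nondeg: "\<And>u. u \<noteq> 0 \<Longrightarrow> \<exists>v. b u v \<noteq> 0"
    and Y: "subspace Y" and "finite B"
  shows "\<exists>P. biorthogonal b P \<and> span (fst ` P) = span B \<and>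
    (\<forall>p\<in>P. (\<forall>y\<in>Y. b (fst p) y = 0) \<or> snd p \<in> Y)"
  using \<open>finite B\<close>
proof (induction B rule: finite_induct)
  case empty
  show ?case
    by (intro exI[of _ "{}"]) (auto simp: biorthogonal_def)
next
  case (insert u B)
  then obtain P where P: "biorthogonal b P" and sp: "span (fst ` P) = span B"
    and adapted: "\<And>p. p \<in> P \<Longrightarrow> (\<forall>y\<in>Y. b (fst p) y = 0) \<or> snd p \<in> Y"
    by blast
  have lin1: "linear (\<lambda>u. b u v)" and lin2: "linear (b u)" for u v
    using bil by (auto simp: bilinear_def)
  define s where "s = (\<Sum>p\<in>P. b u (snd p) *\<^sub>R fst p)"
  define u' where "u' = u - s"
  have s: "s \<in> span (fst ` P)"
    unfolding s_def by (intro span_sum span_scale span_base) auto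
  have u'_snd: "b u' (snd p) = 0" if "p \<in> P" for p
    unfolding u'_def s_def
    by (simp add: linear_diff[OF lin1] biorthogonal_sum_left[OF bil P that])
  show ?case
  proof (cases "u' = 0")
    case True
    then have "u \<in> span B"
      using s sp by (simp add: u'_def)
    then show ?thesis
      using P sp adapted by (intro exI[of _ P]) (auto simp: span_redundant)
  next
    case False
    \<comment> \<open>If \<open>u'\<close> does not vanish on \<open>Y\<close>, a partner is
      available inside \<open>Y\<close>; otherwise any \<open>x\<close> with
      \<open>b u' x \<noteq> 0\<close> will do.\<close>
    obtain x where x: "b u' x \<noteq> 0" "(\<forall>y\<in>Y. b u' y = 0) \<or> x \<in> Y"
      using nondeg[OF False] by blast
    define z where "z = x - (\<Sum>p\<in>P. b (fst p) x *\<^sub>R snd p)"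
    have fst_z: "b (fst p) z = 0" if "p \<in> P" for p
      unfolding z_def
      by (simp add: linear_diff[OF lin2] biorthogonal_sum_right[OF bil P that])
    have "b u' (\<Sum>p\<in>P. b (fst p) x *\<^sub>R snd p) = 0"
      by (simp add: linear_sum[OF lin2] linear_scale[OF lin2] u'_snd)
    then have u'_z: "b u' z = b u' x"
      by (simp add: z_def linear_diff[OF lin2])
    define x' where "x' = inverse (b u' x) *\<^sub>R z"
    have u'_x': "b u' x' = 1"
      using x by (simp add: x'_def linear_scale[OF lin2] u'_z)
    have fst_x': "b (fst p) x' = 0" if "p \<in> P" for p
      using that by (simp add: x'_def linear_scale[OF lin2] fst_z)
    have "z \<in> Y" if "x \<in> Y"
      unfolding z_def using Y that adapted by (rule biorthogonal_remainder_in_subspace)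
    then have x'_Y: "(\<forall>y\<in>Y. b u' y = 0) \<or> x' \<in> Y"
      using x(2) by (auto simp: x'_def subspace_scale[OF Y])
    have notin: "(u', x') \<notin> P"
      using fst_x' u'_x' by force
    have "biorthogonal b (insert (u', x') P)"
      using P notin by (auto simp: biorthogonal_def u'_snd fst_x' u'_x')
    moreover have "span (insert u' (fst ` P)) = span (insert u B)"
    proof (rule span_eq[THEN iffD2], intro conjI insert_subsetI)
      have mono: "span B \<subseteq> span (insert u B)" "span (fst ` P) \<subseteq> span (insert u' (fst ` P))"
        by (auto intro!: span_mono)
      show "u' \<in> span (insert u B)"
        unfolding u'_def using s sp mono by (intro span_diff) (auto intro: span_base)
      show "fst ` P \<subseteq> span (insert u B)"
        using sp mono span_superset[of "fst ` P"] by blast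
      have "u' + s \<in> span (insert u' (fst ` P))"
        using s mono by (intro span_add) (auto intro: span_base)
      then show "u \<in> span (insert u' (fst ` P))"
        by (simp add: u'_def)
      show "B \<subseteq> span (insert u' (fst ` P))"
        using sp mono span_superset[of B] by blast
    qed
    ultimately show ?thesis
      using adapted x'_Y by (intro exI[of _ "insert (u', x') P"]) auto
  qed
qed

lemma bilinear_blinfun_apply: "bilinear (\<lambda>(f :: 'a::real_normed_vector \<Rightarrow>\<^sub>L 'b::real_normed_vector). blinfun_apply f)"
  unfolding bilinear_def
  by (auto intro: bounded_linear.linear blinfun.bounded_linear_right blinfun.bounded_linear_left)

lemma ex_adapted_biorthogonal_blinfun:
  fixes B :: "('a::real_normed_vector \<Rightarrow>\<^sub>L real) set"
  assumes "subspace Y" and "finite B"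
  obtains P where "biorthogonal blinfun_apply P" "span (fst ` P) = span B"
    "\<And>p. p \<in> P \<Longrightarrow> fst p \<in> annihilator Y \<or> snd p \<in> Y"
proof -
  have "\<exists>x. f x \<noteq> 0" if "f \<noteq> 0" for f :: "'a \<Rightarrow>\<^sub>L real"
    using that blinfun_eqI[of f 0] by auto
  from ex_adapted_biorthogonal[OF bilinear_blinfun_apply this assms] show thesis
    using that by (auto simp: annihilator_def)
qed

text \<open>With an adapted system for \<open>span C\<close>, let \<open>g\<close> agree with
  \<open>f\<close> at the vectors \<open>snd p\<close>. Subtracting from \<open>y\<close> its
  expansion leaves an element of \<open>Y\<close> killed by \<open>C\<close>, hence by
  \<open>f\<close>, which says \<open>f y = g y\<close>.\<close>

lemma in_span_modulo_annihilator:
  fixes f :: "'a::real_normed_vector \<Rightarrow>\<^sub>L real"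
  assumes Y: "subspace Y" and "finite C"
    and f: "\<And>y. y \<in> Y \<Longrightarrow> (\<And>g. g \<in> C \<Longrightarrow> blinfun_apply g y = 0) \<Longrightarrow> f y = 0"
  obtains g where "g \<in> span C" "f - g \<in> annihilator Y"
proof -
  obtain P where P: "biorthogonal blinfun_apply P" and sp: "span (fst ` P) = span C"
    and adapted: "\<And>p. p \<in> P \<Longrightarrow> fst p \<in> annihilator Y \<or> snd p \<in> Y"
    using ex_adapted_biorthogonal_blinfun[OF Y \<open>finite C\<close>] by metis
  define g where "g = (\<Sum>p\<in>P. f (snd p) *\<^sub>R fst p)"
  have "g \<in> span (fst ` P)"
    unfolding g_def by (intro span_sum span_scale span_base) auto
  moreover have "f y = g y" if y: "y \<in> Y" for y
  proof -
    define z where "z = y - (\<Sum>p\<in>P. blinfun_apply (fst p) y *\<^sub>R snd p)"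
    have "z \<in> Y"
      unfolding z_def using adapted
      by (intro biorthogonal_remainder_in_subspace[OF Y y]) (auto simp: annihilator_def)
    moreover have "h z = 0" if "h \<in> span (fst ` P)" for h
      using that
    proof (induction rule: span_induct)
      case base
      show ?case
        by (auto simp: subspace_def blinfun.bilinear_simps)
    next
      case (step h)
      then show ?case
        using biorthogonal_sum_right[OF bilinear_blinfun_apply P]
        by (auto simp: z_def blinfun.diff_right)
    qed
    ultimately have "f z = 0"
      using sp by (intro f) (auto intro: span_base)
    then show ?thesis
      by (simp add: z_def g_def blinfun.bilinear_simps mult.commute)
  qed
  ultimately show thesis
    using sp by (intro that[of g]) (auto simp: annihilator_def blinfun.diff_left)
qed

section \<open>Local reflexivity for pairs\<close>

text \<open>The ball itself need not be totally bounded, but its image under finitely many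
  functionals is. Rounding their values to multiples of \<open>d\<close> leaves finitely many
  patterns, and \<open>W\<close> contains a representative of each.\<close>

lemma ex_finite_net_unit_ball:
  fixes R :: "('a::real_normed_vector \<Rightarrow>\<^sub>L real) set"
  assumes "finite R" and d: "d > 0"
  obtains W where "finite W" "W \<subseteq> cball 0 1"
    "\<And>x. x \<in> cball 0 1 \<Longrightarrow> \<exists>w\<in>W. \<forall>r\<in>R. \<bar>r x - r w\<bar> \<le> d"
proof -
  define \<phi> where "\<phi> x = restrict (\<lambda>r. \<lfloor>blinfun_apply r x / d\<rfloor>) R" for x
  have "\<phi> ` cball 0 1 \<subseteq> (\<Pi>\<^sub>E r\<in>R. {\<lfloor>- norm r / d\<rfloor>..\<lfloor>norm r / d\<rfloor>})"
  proof (clarsimp simp: \<phi>_def)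
    fix x :: 'a and r
    assume "norm x \<le> 1" "r \<in> R"
    then have "\<bar>r x\<bar> \<le> norm r"
      using norm_blinfun[of r x] mult_left_mono[of "norm x" 1 "norm r"] by simp
    then show "\<lfloor>- (norm r / d)\<rfloor> \<le> \<lfloor>r x / d\<rfloor> \<and> \<lfloor>r x / d\<rfloor> \<le> \<lfloor>norm r / d\<rfloor>"
      using d by (auto intro!: floor_mono simp: field_simps)
  qed
  then have "finite (\<phi> ` cball 0 1)"
    using \<open>finite R\<close> by (auto intro: finite_PiE elim: finite_subset)
  then obtain W where W: "W \<subseteq> cball 0 1" "finite W" "\<phi> ` cball 0 1 = \<phi> ` W"
    using finite_subset_image[of "\<phi> ` cball 0 1" \<phi> "cball 0 1"] by auto
  show thesis
  proof (rule that[OF W(2,1)])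
    fix x :: 'a
    assume "x \<in> cball 0 1"
    then obtain w where w: "w \<in> W" "\<phi> x = \<phi> w"
      using W(3) by blast
    have "\<bar>r x - r w\<bar> \<le> d" if "r \<in> R" for r
    proof -
      have "\<lfloor>r x / d\<rfloor> = \<lfloor>r w / d\<rfloor>"
        using fun_cong[OF w(2), of r] that by (simp add: \<phi>_def)
      then have "\<bar>r x / d - r w / d\<bar> \<le> 1"
        by linarith
      then show ?thesis
        using d by (simp add: field_simps flip: diff_divide_distrib)
    qed
    then show "\<exists>w\<in>W. \<forall>r\<in>R. \<bar>r x - r w\<bar> \<le> d"
      using w by blast
  qed
qed

text \<open>Bounded sequences supported on the first \<open>m\<close> places model
  \<open>m\<close>-tuples with the maximum norm, in a type that does not depend on
  \<open>m\<close>.\<close>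

definition trunc_seq :: "nat \<Rightarrow> (nat \<Rightarrow> 'a::real_normed_vector) \<Rightarrow> nat \<Rightarrow>\<^sub>C 'a" where
  "trunc_seq m x = Bcontfun (\<lambda>n. if n < m then x n else 0)"

lemma trunc_seq_apply [simp]: "trunc_seq m x n = (if n < m then x n else 0)"
proof -
  have "norm (if n < m then x n else 0) \<le> (\<Sum>k<m. norm (x k))" for n
    by (auto intro: member_le_sum sum_nonneg)
  then have "(\<lambda>n. if n < m then x n else 0) \<in> bcontfun"
    by (rule bcontfun_normI[rotated]) auto
  then show ?thesis
    by (simp add: trunc_seq_def Bcontfun_inverse)
qed

lemma norm_blinfun_bound_unit_ball:
  fixes T :: "'a::real_normed_vector \<Rightarrow>\<^sub>L 'b::real_normed_vector"
  assumes le: "\<And>x. norm x \<le> 1 \<Longrightarrow> norm (T x) \<le> c"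
  shows "norm T \<le> c"
proof (rule norm_blinfun_bound)
  show "0 \<le> c"
    using le[of 0] by simp
  show "norm (T x) \<le> c * norm x" for x
    using le[of "inverse (norm x) *\<^sub>R x"]
    by (cases "x = 0") (auto simp: blinfun.scaleR_right field_simps)
qed

lemma ex_almost_norming:
  fixes f :: "'a::real_normed_vector \<Rightarrow>\<^sub>L real"
  assumes e: "e > 0"
  shows "\<exists>x. norm x \<le> 1 \<and> norm f - e \<le> f x"
proof (rule ccontr)
  assume "\<not> ?thesis"
  then have less: "f x < norm f - e" if "norm x \<le> 1" for x
    using that by force
  have "norm f \<le> norm f - e"
  proof (rule norm_blinfun_bound_unit_ball)
    show "norm (f x) \<le> norm f - e" if "norm x \<le> 1" for x
      using less[of x] less[of "- x"] that by (simp add: blinfun.minus_right abs_le_iff)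
  qed
  then show False
    using e by simp
qed

text \<open>The dual of a finite sup-norm sum is the l1-sum of the duals. For the norm estimate,
  \<open>\<Psi>\<close> is evaluated at a tuple of almost norming vectors, which has norm at most
  1.\<close>

lemma dual_bcontfun_nat_decomposition:
  fixes \<Psi> :: "(nat \<Rightarrow>\<^sub>C 'a::real_normed_vector) \<Rightarrow>\<^sub>L real"
  obtains f :: "nat \<Rightarrow> 'a \<Rightarrow>\<^sub>L real"
  where "\<And>x. \<Psi> (trunc_seq m x) = (\<Sum>l<m. f l (x l))" "(\<Sum>l<m. norm (f l)) \<le> norm \<Psi>"
proof -
  define \<iota> where "\<iota> l x = trunc_seq (Suc l) (\<lambda>n. if n = l then x else 0)" for l and x :: 'a
  have \<iota>_apply: "\<iota> l x n = (if n = l then x else 0)" for l x n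
    by (simp add: \<iota>_def)
  have "bounded_linear (\<iota> l)" for l
  proof (rule bounded_linear_intro)
    show "norm (\<iota> l x) \<le> norm x * 1" for x
      by (rule norm_bound) (simp add: \<iota>_apply)
  qed (auto intro!: bcontfun_eqI simp: \<iota>_apply)
  then have bl: "bounded_linear (\<lambda>x. \<Psi> (\<iota> l x))" for l
    by (rule bounded_linear_compose[OF blinfun.bounded_linear_right])
  define f where "f l = Blinfun (\<lambda>x. \<Psi> (\<iota> l x))" for l
  have f_apply: "f l x = \<Psi> (\<iota> l x)" for l x
    by (simp add: f_def bounded_linear_Blinfun_apply[OF bl])
  have sum_apply: "(\<Sum>l\<in>A. \<iota> l (x l)) n = (\<Sum>l\<in>A. \<iota> l (x l) n)" for A x n
    by (induction A rule: infinite_finite_induct) auto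
  have "trunc_seq m x = (\<Sum>l<m. \<iota> l (x l))" for x
    by (rule bcontfun_eqI) (simp add: sum_apply \<iota>_apply)
  then have dec: "\<Psi> (trunc_seq m x) = (\<Sum>l<m. f l (x l))" for x
    by (simp add: f_apply blinfun.sum_right)
  have "(\<Sum>l<m. norm (f l)) \<le> norm \<Psi> + e" if e: "e > 0" for e
  proof -
    \<comment> \<open>The \<open>m\<close> errors \<open>e'\<close> add up to at most
      \<open>e\<close>; the \<open>+ 1\<close> covers \<open>m = 0\<close>.\<close>
    define e' where "e' = e / (m + 1)"
    have e': "e' > 0"
      using e by (simp add: e'_def)
    obtain x where x: "\<And>l. norm (x l) \<le> 1" "\<And>l. norm (f l) - e' \<le> f l (x l)"
      using choice[of "\<lambda>l x. norm x \<le> 1 \<and> norm (f l) - e' \<le> f l x"] ex_almost_norming[OF e']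
      by blast
    have nx: "norm (trunc_seq m x) \<le> 1"
      by (rule norm_bound) (use x in auto)
    have "(\<Sum>l<m. norm (f l)) - m * e' = (\<Sum>l<m. norm (f l) - e')"
      by (simp add: sum_subtractf)
    also have "\<dots> \<le> \<Psi> (trunc_seq m x)"
      unfolding dec using x by (intro sum_mono)
    also have "\<dots> \<le> norm \<Psi> * norm (trunc_seq m x)"
      using norm_blinfun[of \<Psi> "trunc_seq m x"] by simp
    also have "\<dots> \<le> norm \<Psi>"
      using nx by (simp add: mult_left_le)
    finally have "(\<Sum>l<m. norm (f l)) \<le> norm \<Psi> + m * e'"
      by simp
    moreover have "m * e' \<le> e"
      using e by (simp add: e'_def field_simps)
    ultimately show ?thesis
      by simp
  qed
  then have "(\<Sum>l<m. norm (f l)) \<le> norm \<Psi>"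
    by (rule field_le_epsilon)
  with dec show thesis
    by (rule that)
qed

definition rank_one :: "('a::real_normed_vector \<Rightarrow>\<^sub>L real) \<Rightarrow> 'a \<Rightarrow> 'a \<Rightarrow>\<^sub>L 'a" where
  "rank_one r z = blinfun_scaleR_left z o\<^sub>L r"

lemma rank_one_apply [simp]: "rank_one r z x = r x *\<^sub>R z"
  by (simp add: rank_one_def)

text \<open>\<open>B\<close> and \<open>C\<close> are separate because \<open>S\<close> need not fix
  its range. If \<open>S\<close> is a projection with range \<open>span C\<close>, then
  \<open>B = C\<close> is allowed and the last two conclusions make \<open>T\<close> a
  projection.\<close>

theorem local_reflexivity_pair:
  fixes Y :: "'a::real_normed_vector set" and S :: "('a \<Rightarrow>\<^sub>L real) \<Rightarrow>\<^sub>L ('a \<Rightarrow>\<^sub>L real)"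
  assumes Y: "subspace Y" and "finite B" and SB: "range S \<subseteq> span B"
    and "finite C" and SC: "\<And>g. g \<in> C \<Longrightarrow> S g = g"
    and SY: "S ` annihilator Y \<subseteq> annihilator Y" and e: "e > 0"
  obtains T :: "'a \<Rightarrow>\<^sub>L 'a"
  where "finite_rank T" "T ` Y \<subseteq> Y" "norm T \<le> norm S + e"
    "\<And>g. g \<in> C \<Longrightarrow> g o\<^sub>L T = g" "\<And>f. f o\<^sub>L T \<in> span B"
proof -
  obtain P where P: "biorthogonal blinfun_apply P" and sp: "span (fst ` P) = span B"
    and adapted: "\<And>p. p \<in> P \<Longrightarrow> fst p \<in> annihilator Y \<or> snd p \<in> Y"
    using ex_adapted_biorthogonal_blinfun[OF Y \<open>finite B\<close>] by metis
  note finP = biorthogonal_finite[OF P]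
  have expand: "f x = (\<Sum>p\<in>P. f (snd p) * blinfun_apply (fst p) x)" if "f \<in> span B" for f x
  proof -
    have "f = (\<Sum>p\<in>P. f (snd p) *\<^sub>R fst p)"
      using biorthogonal_expansion[OF bilinear_blinfun_apply P] that sp by simp
    from arg_cong[OF this, of "\<lambda>f. blinfun_apply f x"] show ?thesis
      by (simp add: blinfun.bilinear_simps)
  qed
  define T\<^sub>0 where "T\<^sub>0 = (\<Sum>p\<in>P. rank_one (fst p) (snd p))"
  have T\<^sub>0_apply: "T\<^sub>0 x = (\<Sum>p\<in>P. blinfun_apply (fst p) x *\<^sub>R snd p)" for x
    by (simp add: T\<^sub>0_def blinfun.sum_left)
  have T\<^sub>0_Y: "T\<^sub>0 y \<in> Y" if "y \<in> Y" for y
    unfolding T\<^sub>0_apply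
  proof (rule subspace_sum[OF Y])
    fix p
    assume "p \<in> P"
    then show "blinfun_apply (fst p) y *\<^sub>R snd p \<in> Y"
      using adapted[of p] that by (auto simp: annihilator_def subspace_0[OF Y] subspace_scale[OF Y])
  qed
  have C_span: "g \<in> span B" if "g \<in> C" for g
    using SC[OF that] SB by (metis rangeI subsetD)
  have T\<^sub>0_span: "g (T\<^sub>0 x) = g x" if "g \<in> span B" for g x
    using expand[OF that, of x] by (simp add: T\<^sub>0_apply blinfun.bilinear_simps mult.commute)
  have T\<^sub>0_idem: "T\<^sub>0 (T\<^sub>0 x) = T\<^sub>0 x" for x
  proof -
    have "fst p (T\<^sub>0 x) = fst p x" if "p \<in> P" for p
      using that sp by (intro T\<^sub>0_span) (auto intro: span_base)
    then show ?thesis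
      unfolding T\<^sub>0_apply[of "T\<^sub>0 x"] by (simp add: T\<^sub>0_apply[symmetric])
  qed

  \<comment> \<open>The operators \<open>T\<^sub>0 - n\<close> with \<open>n \<in> N\<close> are the admissible ones apart from their norm, so
    the distance from \<open>T\<^sub>0\<close> to \<open>N\<close> has to be estimated; the norm is replaced by the maximum over
    a finite net of the unit ball, which embeds the problem in a space of bounded sequences.\<close>
  define N where "N = {T. (\<forall>x. blinfun_apply T (T\<^sub>0 x) = T x) \<and> (\<forall>y\<in>Y. T y \<in> Y) \<and>
    (\<forall>g\<in>C. \<forall>x. blinfun_apply g (T x) = 0)}"
  have "subspace N"
    by (rule subspaceI)
      (auto simp: N_def blinfun.bilinear_simps subspace_0[OF Y] subspace_add[OF Y] subspace_scale[OF Y])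

  \<comment> \<open>Chosen so that \<open>norm S + \<delta> = (1 - \<delta>) * (norm S + e)\<close>;
    this absorbs the term \<open>\<delta> * norm T\<close> in the final norm estimate.\<close>
  define \<delta> where "\<delta> = e / (1 + norm S + e)"
  have "0 < 1 + norm S" "0 < 1 + norm S + e"
    using e norm_ge_zero[of S] by linarith+
  then have \<delta>: "\<delta> > 0" "\<delta> < 1" "\<delta> * (1 + norm S + e) = e"
    using e by (auto simp: \<delta>_def)
  define K where "K = (\<Sum>p\<in>P. norm (snd p))"
  have K: "K \<ge> 0"
    by (simp add: K_def sum_nonneg)
  \<comment> \<open>With this mesh, moving \<open>x\<close> to a net point changes
    \<open>T x\<close> by at most \<open>\<delta> * norm T * (K / (K + 1))\<close>; the
    \<open>+ 1\<close> covers \<open>K = 0\<close>.\<close>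
  obtain W where W: "finite W" "W \<subseteq> cball 0 1"
    "\<And>x. x \<in> cball 0 1 \<Longrightarrow> \<exists>w\<in>W. \<forall>r\<in>fst ` P. \<bar>blinfun_apply r x - r w\<bar> \<le> \<delta> / (K + 1)"
    using ex_finite_net_unit_ball[of "fst ` P" "\<delta> / (K + 1)"] finP \<delta>(1) K by auto
  obtain w and m :: nat where w: "W = w ` {..<m}"
    using finite_imp_nat_seg_image_inj_on[OF W(1)] by (auto simp: lessThan_def)
  have norm_w: "norm (w l) \<le> 1" if "l < m" for l
    using W(2) w that by auto

  define J where "J T = trunc_seq m (\<lambda>l. blinfun_apply T (w l))" for T :: "'a \<Rightarrow>\<^sub>L 'a"
  have "linear J"
    by (rule linearI) (auto intro!: bcontfun_eqI simp: J_def blinfun.add_left blinfun.scaleR_left)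
  define M where "M = J ` N"
  have M: "subspace M"
    unfolding M_def using \<open>linear J\<close> \<open>subspace N\<close> by (rule linear_subspace_image)
  obtain \<Psi> where \<Psi>: "norm \<Psi> \<le> 1" "\<And>z. z \<in> M \<Longrightarrow> blinfun_apply \<Psi> z = 0"
    "\<Psi> (J T\<^sub>0) = infdist (J T\<^sub>0) M"
    using Hahn_Banach_infdist[OF M] by metis
  obtain f where f: "\<And>x. \<Psi> (trunc_seq m x) = (\<Sum>l<m. blinfun_apply (f l) (x l))"
    "(\<Sum>l<m. norm (f l)) \<le> norm \<Psi>"
    using dual_bcontfun_nat_decomposition[of \<Psi> m] by metis
  \<comment> \<open>\<open>H p z\<close> is the value of \<open>\<Psi>\<close> at
    \<open>J (rank_one (fst p) z)\<close>.\<close>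
  define H where "H p = (\<Sum>l<m. blinfun_apply (fst p) (w l) *\<^sub>R f l)" for p :: "('a \<Rightarrow>\<^sub>L real) \<times> 'a"
  have H_apply: "H p x = (\<Sum>l<m. blinfun_apply (fst p) (w l) * f l x)" for p x
    by (simp add: H_def blinfun.bilinear_simps)

  \<comment> \<open>\<open>H p\<close> vanishes at each \<open>z\<close> for which
    \<open>rank_one (fst p) z\<close> is in \<open>N\<close>, so it is an element of
    \<open>span C\<close> plus an annihilator of \<open>Y'\<close>. \<open>S\<close> fixes the
    former and keeps the latter an annihilator of \<open>Y'\<close>, which does not contribute at
    \<open>snd p\<close>.\<close>
  have SH: "H p (snd p) = S (H p) (snd p)" if p: "p \<in> P" for p
  proof -
    \<comment> \<open>\<open>rank_one (fst p) z\<close> preserves \<open>Y\<close> if \<open>z \<in> Y'\<close>, and \<open>snd p\<close> always lies in \<open>Y'\<close>.\<close>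
    define Y' where "Y' = (if snd p \<in> Y then Y else UNIV)"
    have Y': "subspace Y'"
      using Y by (simp add: Y'_def)
    have "H p z = 0" if z: "z \<in> Y'" and Cz: "\<And>g. g \<in> C \<Longrightarrow> blinfun_apply g z = 0" for z
    proof -
      have "fst p \<in> span B"
        using p sp by (auto intro: span_base)
      then have "fst p (T\<^sub>0 x) = fst p x" for x
        by (rule T\<^sub>0_span)
      moreover have "blinfun_apply (fst p) y *\<^sub>R z \<in> Y" if "y \<in> Y" for y
        using adapted[OF p] z that
        by (auto simp: Y'_def annihilator_def subspace_0[OF Y] subspace_scale[OF Y] split: if_splits)
      ultimately have "rank_one (fst p) z \<in> N"
        using Cz by (simp add: N_def blinfun.scaleR_right)
      then have "\<Psi> (J (rank_one (fst p) z)) = 0"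
        by (intro \<Psi>(2)) (simp add: M_def)
      then show ?thesis
        by (simp add: J_def f(1) H_apply blinfun.scaleR_right)
    qed
    then obtain g where g: "g \<in> span C" "H p - g \<in> annihilator Y'"
      using in_span_modulo_annihilator[OF Y' \<open>finite C\<close>] by metis
    have "S g = g"
      using g(1)
    proof (induction rule: span_induct)
      case base
      show ?case
        by (auto simp: subspace_def blinfun.bilinear_simps)
    qed (rule SC)
    have snd_p: "snd p \<in> Y'"
      by (simp add: Y'_def)
    have "S (H p - g) \<in> annihilator Y'"
    proof (cases "snd p \<in> Y")
      case True
      then show ?thesis
        using g(2) SY by (auto simp: Y'_def)
    next
      case False
      then have "H p - g = 0"
        using g(2) by (intro blinfun_eqI) (simp add: Y'_def annihilator_def)
      then show ?thesis
        by (simp add: annihilator_def)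
    qed
    then show ?thesis
      using g(2) snd_p \<open>S g = g\<close> by (auto simp: annihilator_def blinfun.diff_left blinfun.diff_right)
  qed

  have "infdist (J T\<^sub>0) M = \<Psi> (J T\<^sub>0)"
    by (rule \<Psi>(3)[symmetric])
  also have "\<dots> = (\<Sum>l<m. \<Sum>p\<in>P. blinfun_apply (fst p) (w l) * f l (snd p))"
    by (simp add: J_def f(1) T\<^sub>0_apply blinfun.bilinear_simps)
  also have "\<dots> = (\<Sum>p\<in>P. H p (snd p))"
    unfolding H_apply by (rule sum.swap)
  also have "\<dots> = (\<Sum>p\<in>P. S (H p) (snd p))"
    using SH by simp
  also have "\<dots> = (\<Sum>p\<in>P. \<Sum>l<m. blinfun_apply (fst p) (w l) * S (f l) (snd p))"
    by (simp add: H_def blinfun.bilinear_simps)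
  also have "\<dots> = (\<Sum>l<m. \<Sum>p\<in>P. blinfun_apply (fst p) (w l) * S (f l) (snd p))"
    by (rule sum.swap)
  \<comment> \<open>Since \<open>S (f l)\<close> is in \<open>span B\<close>, its expansion removes
    the biorthogonal system from the formula.\<close>
  also have "\<dots> = (\<Sum>l<m. S (f l) (w l))"
  proof (rule sum.cong)
    fix l
    have "S (f l) \<in> span B"
      using SB by blast
    then show "(\<Sum>p\<in>P. blinfun_apply (fst p) (w l) * S (f l) (snd p)) = S (f l) (w l)"
      using expand[of "S (f l)" "w l"] by (simp add: mult.commute)
  qed simp
  also have "\<dots> \<le> (\<Sum>l<m. norm S * norm (f l))"
  proof (rule sum_mono)
    fix l
    assume l: "l \<in> {..<m}"
    have "S (f l) (w l) \<le> norm (S (f l)) * norm (w l)"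
      using norm_blinfun[of "S (f l)" "w l"] by simp
    also have "\<dots> \<le> norm (S (f l))"
      using norm_w l by (simp add: mult_left_le)
    also have "\<dots> \<le> norm S * norm (f l)"
      by (rule norm_blinfun)
    finally show "S (f l) (w l) \<le> norm S * norm (f l)" .
  qed
  also have "\<dots> = norm S * (\<Sum>l<m. norm (f l))"
    by (simp add: sum_distrib_left)
  also have "\<dots> \<le> norm S"
    using f(2) \<Psi>(1) by (simp add: mult_left_le)
  finally have "infdist (J T\<^sub>0) M < norm S + \<delta>"
    using \<delta> by simp
  moreover have "M \<noteq> {}"
    using subspace_0[OF M] by auto
  ultimately obtain n where n: "n \<in> N" "dist (J T\<^sub>0) (J n) < norm S + \<delta>"
    by (auto simp: infdist_notempty cINF_less_iff M_def)

  define T where "T = T\<^sub>0 - n"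
  \<comment> \<open>\<open>T x\<close> depends on \<open>x\<close> only through the numbers
    \<open>fst p x\<close>, which the net controls; so bounds at net points extend to the unit
    ball.\<close>
  have T_expand: "T x = (\<Sum>p\<in>P. blinfun_apply (fst p) x *\<^sub>R T (snd p))" for x
  proof -
    have "T x = T (T\<^sub>0 x)"
      using n(1) T\<^sub>0_idem by (simp add: T_def N_def blinfun.diff_left)
    then show ?thesis
      by (simp add: T\<^sub>0_apply blinfun.bilinear_simps)
  qed
  have T_w: "norm (T (w l)) \<le> norm S + \<delta>" if "l < m" for l
  proof -
    have "norm (T (w l)) = norm ((J T\<^sub>0 - J n) l)"
      using that by (simp add: T_def J_def blinfun.diff_left)
    also have "\<dots> \<le> dist (J T\<^sub>0) (J n)"
      unfolding dist_norm by (rule norm_bounded)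
    finally show ?thesis
      using n(2) by simp
  qed
  have "norm T \<le> norm S + \<delta> + \<delta> * norm T"
  proof (rule norm_blinfun_bound_unit_ball)
    fix x :: 'a
    assume "norm x \<le> 1"
    then obtain l where l: "l < m" "\<And>p. p \<in> P \<Longrightarrow> \<bar>blinfun_apply (fst p) x - blinfun_apply (fst p) (w l)\<bar> \<le> \<delta> / (K + 1)"
      using W(3)[of x] w by auto
    have "T x - T (w l) = (\<Sum>p\<in>P. (blinfun_apply (fst p) x - blinfun_apply (fst p) (w l)) *\<^sub>R T (snd p))"
      by (subst (1 2) T_expand) (simp add: scaleR_left_diff_distrib sum_subtractf)
    also have "norm \<dots> \<le> (\<Sum>p\<in>P. \<delta> / (K + 1) * (norm T * norm (snd p)))"
    proof (rule sum_norm_le)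
      fix p
      assume "p \<in> P"
      then show "norm ((fst p x - fst p (w l)) *\<^sub>R T (snd p)) \<le> \<delta> / (K + 1) * (norm T * norm (snd p))"
        unfolding norm_scaleR using l(2) \<delta>(1) K by (intro mult_mono norm_blinfun) auto
    qed
    also have "\<dots> = \<delta> / (K + 1) * (norm T * (\<Sum>p\<in>P. norm (snd p)))"
      by (simp only: sum_distrib_left)
    also have "\<dots> = \<delta> * norm T * (K / (K + 1))"
      by (simp flip: K_def)
    also have "\<dots> \<le> \<delta> * norm T * 1"
      using \<delta>(1) K by (intro mult_left_mono) auto
    finally show "norm (T x) \<le> norm S + \<delta> + \<delta> * norm T"
      using T_w[OF l(1)] norm_triangle_sub[of "T x" "T (w l)"] by simp
  qed
  then have "(1 - \<delta>) * norm T \<le> (1 - \<delta>) * (norm S + e)"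
    using \<delta>(3) by (simp add: algebra_simps)
  then have norm_T: "norm T \<le> norm S + e"
    using \<delta>(2) by simp
  have "range T \<subseteq> span (T ` snd ` P)"
  proof clarify
    fix x
    show "T x \<in> span (T ` snd ` P)"
      by (subst T_expand, intro span_sum span_scale span_base) auto
  qed
  then have "finite_rank T"
    unfolding finite_rank_def using finP
    by (intro exI[of _ "T ` snd ` P"] conjI finite_imageI)
  moreover have "T ` Y \<subseteq> Y"
    using n(1) T\<^sub>0_Y by (auto simp: T_def N_def blinfun.diff_left subspace_diff[OF Y])
  moreover have "g o\<^sub>L T = g" if "g \<in> C" for g
    using n(1) T\<^sub>0_span[OF C_span[OF that]] that
    by (intro blinfun_eqI) (auto simp: T_def N_def blinfun.diff_left blinfun.diff_right)
  moreover have "f o\<^sub>L T \<in> span B" for f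
  proof -
    have "f o\<^sub>L T = (\<Sum>p\<in>P. f (T (snd p)) *\<^sub>R fst p)"
    proof (rule blinfun_eqI)
      fix x
      show "(f o\<^sub>L T) x = (\<Sum>p\<in>P. f (T (snd p)) *\<^sub>R fst p) x"
        by (simp, subst T_expand) (simp add: blinfun.bilinear_simps mult.commute)
    qed
    also have "\<dots> \<in> span (fst ` P)"
      by (intro span_sum span_scale span_base) auto
    finally show ?thesis
      using sp by simp
  qed
  ultimately show thesis
    using norm_T by (intro that)
qed

section \<open>Products of complementary operators\<close>

text \<open>The coefficients of \<open>T x\<close> in a biorthogonal system for
  \<open>span B\<close> are the functionals \<open>snd p o\<^sub>L T\<close>, and these span the
  range of the adjoint.\<close>

lemma finite_rank_adjoint:
  fixes T :: "'a::real_normed_vector \<Rightarrow>\<^sub>L 'a"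
  assumes "finite_rank T"
  obtains D :: "('a \<Rightarrow>\<^sub>L real) set" where "finite D" "\<And>f. f o\<^sub>L T \<in> span D"
proof -
  obtain B where B: "finite B" "range T \<subseteq> span B"
    using assms by (auto simp: finite_rank_def)
  let ?b = "\<lambda>x f. blinfun_apply (f :: 'a \<Rightarrow>\<^sub>L real) x"
  have bil: "bilinear ?b"
    using bilinear_blinfun_apply by (auto simp: bilinear_def)
  obtain P where P: "biorthogonal ?b P" "span (fst ` P) = span B"
    using ex_adapted_biorthogonal[OF bil ex_blinfun_apply_nonzero subspace_UNIV B(1)] by blast
  have expand: "f o\<^sub>L T = (\<Sum>p\<in>P. f (fst p) *\<^sub>R (snd p o\<^sub>L T))" for f
  proof (rule blinfun_eqI)
    fix x
    have "T x = (\<Sum>p\<in>P. blinfun_apply (snd p) (T x) *\<^sub>R fst p)"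
      using B(2) P(2) by (intro biorthogonal_expansion[OF bil P(1)]) auto
    from arg_cong[OF this, of f]
    show "(f o\<^sub>L T) x = (\<Sum>p\<in>P. f (fst p) *\<^sub>R (snd p o\<^sub>L T)) x"
      by (simp add: blinfun.bilinear_simps mult.commute)
  qed
  have "f o\<^sub>L T \<in> span ((\<lambda>p. snd p o\<^sub>L T) ` P)" for f
    by (subst expand, intro span_sum span_scale span_base) auto
  then show thesis
    using biorthogonal_finite[OF P(1)] by (intro that[of "(\<lambda>p. snd p o\<^sub>L T) ` P"]) auto
qed

text \<open>Equality matters for a projection: it fixes exactly its range, so \<open>C\<close> can
  serve as both finite sets in \<open>local_reflexivity_pair\<close>.\<close>

lemma finite_rank_range_eq_span:
  fixes S :: "'z::real_normed_vector \<Rightarrow>\<^sub>L 'z"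
  assumes "finite_rank S"
  obtains C where "finite C" "range S = span C"
proof -
  obtain B where B: "finite B" "range S \<subseteq> span B"
    using assms by (auto simp: finite_rank_def)
  obtain C where C: "C \<subseteq> range S" "independent C" "range S \<subseteq> span C"
    using basis_exists by metis
  have "finite C"
    using independent_span_bound[OF B(1) C(2)] C(1) B(2) by blast
  moreover have "subspace (range S)"
    by (intro linear_subspace_image bounded_linear.linear[OF blinfun.bounded_linear_right]) simp
  then have "range S = span C"
    using C span_minimal by blast
  ultimately show thesis
    by (rule that)
qed

text \<open>This is the operator \<open>P\<close> with \<open>I - P = (I - S) (I - T)\<close>.\<close>
definition circle_sum :: "('z::real_normed_vector \<Rightarrow>\<^sub>L 'z) \<Rightarrow> ('z \<Rightarrow>\<^sub>L 'z) \<Rightarrow> 'z \<Rightarrow>\<^sub>L 'z" where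
  "circle_sum S T = S + T - (S o\<^sub>L T)"

lemma circle_sum_apply: "circle_sum S T x = S x + T x - S (T x)"
  by (simp add: circle_sum_def blinfun.bilinear_simps)

lemma finite_rank_circle_sum:
  fixes S T :: "'z::real_normed_vector \<Rightarrow>\<^sub>L 'z"
  assumes "finite_rank S" and "finite_rank T"
  shows "finite_rank (circle_sum S T)"
proof -
  obtain A B where A: "finite A" "range S \<subseteq> span A" and B: "finite B" "range T \<subseteq> span B"
    using assms by (auto simp: finite_rank_def)
  have "S x \<in> span (A \<union> B)" "T x \<in> span (A \<union> B)" for x
    using A(2) B(2) span_mono[of A "A \<union> B"] span_mono[of B "A \<union> B"] by blast+
  then have "range (circle_sum S T) \<subseteq> span (A \<union> B)"
    by (auto simp: circle_sum_apply intro!: span_add span_diff)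
  then show ?thesis
    using A B by (auto simp: finite_rank_def)
qed

lemma circle_sum_image_subset:
  fixes S T :: "'z::real_normed_vector \<Rightarrow>\<^sub>L 'z"
  assumes "subspace W" and "S ` W \<subseteq> W" and "T ` W \<subseteq> W"
  shows "circle_sum S T ` W \<subseteq> W"
proof clarify
  fix x
  assume "x \<in> W"
  then have "S x \<in> W" "T x \<in> W" "S (T x) \<in> W"
    using assms by blast+
  then show "circle_sum S T x \<in> W"
    using assms(1) by (simp add: circle_sum_apply subspace_add subspace_diff)
qed

text \<open>This is the origin of the constant \<open>lam * mu + lam + mu\<close>.\<close>

lemma norm_circle_sum: "norm (circle_sum S T) \<le> norm S + norm T + norm S * norm T"
  unfolding circle_sum_def
  using norm_triangle_ineq4[of "S + T" "S o\<^sub>L T"] norm_triangle_ineq[of S T] norm_blinfun_compose[of S T]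
  by linarith

text \<open>Here \<open>(I - T) (I - S) = I - S\<close>, and \<open>I - S\<close> is
  idempotent.\<close>

lemma circle_sum_idempotent_left:
  fixes S T :: "'z::real_normed_vector \<Rightarrow>\<^sub>L 'z"
  assumes "S o\<^sub>L S = S" and "T o\<^sub>L S = T"
  shows "circle_sum S T o\<^sub>L circle_sum S T = circle_sum S T"
proof -
  have "S (S x) = S x" "T (S x) = T x" for x
    using assms by (metis blinfun_apply_blinfun_compose)+
  then show ?thesis
    by (intro blinfun_eqI) (simp add: circle_sum_apply blinfun.bilinear_simps)
qed

text \<open>Here \<open>(I - T) (I - S) = I - T\<close>, and \<open>I - T\<close> is
  idempotent.\<close>

lemma circle_sum_idempotent_right:
  fixes S T :: "'z::real_normed_vector \<Rightarrow>\<^sub>L 'z"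
  assumes "T o\<^sub>L T = T" and "T o\<^sub>L S = S"
  shows "circle_sum S T o\<^sub>L circle_sum S T = circle_sum S T"
proof -
  have "T (T x) = T x" "T (S x) = S x" for x
    using assms by (metis blinfun_apply_blinfun_compose)+
  then show ?thesis
    by (intro blinfun_eqI) (simp add: circle_sum_apply blinfun.bilinear_simps)
qed

lemma circle_sum_fixes: "blinfun_apply T x = x \<Longrightarrow> circle_sum S T x = x"
  by (simp add: circle_sum_apply)

lemma compose_circle_sum:
  assumes "f o\<^sub>L S = f"
  shows "f o\<^sub>L circle_sum S T = f"
proof (rule blinfun_eqI)
  fix x
  have "f (S y) = f y" for y
    using assms by (metis blinfun_apply_blinfun_compose)
  then show "(f o\<^sub>L circle_sum S T) x = f x"
    by (simp add: circle_sum_apply blinfun.bilinear_simps)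
qed

section \<open>Assembling the projections for the two duality statements\<close>

lemma compose_eq_on_span:
  fixes C :: "('a::real_normed_vector \<Rightarrow>\<^sub>L real) set"
  assumes C: "\<And>g. g \<in> C \<Longrightarrow> g o\<^sub>L T = g" and "g \<in> span C"
  shows "g o\<^sub>L T = g"
proof -
  have "\<forall>x. g (T x) = g x"
    using \<open>g \<in> span C\<close>
  proof (induction rule: span_induct)
    case base
    show ?case
      by (auto simp: subspace_def blinfun.bilinear_simps)
  next
    case (step g)
    then show ?case
      using C by (metis blinfun_apply_blinfun_compose)
  qed
  then show ?thesis
    by (intro blinfun_eqI) simp
qed

lemma ex_norm_slack:
  fixes lam mu :: real
  assumes "lam \<ge> 1" and "mu \<ge> 1" and "\<epsilon> > 0"
  obtains d where "d > 0" "\<And>a b. 0 \<le> b \<Longrightarrow> a \<le> lam + d \<Longrightarrow> b \<le> mu + d \<Longrightarrow>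
    a + b + a * b \<le> lam * mu + lam + mu + \<epsilon>"
proof -
  \<comment> \<open>The excess is at most \<open>d * (lam + mu + 2) + d * d\<close>, and
    \<open>d \<le> 1\<close> bounds this by \<open>d * (lam + mu + 3)\<close>.\<close>
  define d where "d = min 1 (\<epsilon> / (lam + mu + 3))"
  have d: "d > 0" "d \<le> 1" "d * (lam + mu + 3) \<le> \<epsilon>"
    using assms min.cobounded2[of 1 "\<epsilon> / (lam + mu + 3)"]
    by (auto simp: d_def simp flip: pos_le_divide_eq)
  have "a + b + a * b \<le> lam * mu + lam + mu + \<epsilon>" if "0 \<le> b" "a \<le> lam + d" "b \<le> mu + d" for a b
  proof -
    have "a * b \<le> (lam + d) * (mu + d)"
      using that assms d by (intro mult_mono) auto
    moreover have "d * d \<le> d"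
      using d by (simp add: mult_left_le)
    ultimately show ?thesis
      using that d(3) by (simp add: algebra_simps)
  qed
  with d(1) show thesis
    by (rule that)
qed

text \<open>\<open>T\<close> comes first; the dual projection \<open>R\<close> then fixes
  \<open>F\<close> and the range of the adjoint of \<open>T\<close>. Its replacement
  \<open>Q\<close> inherits both, which gives \<open>T o\<^sub>L Q = T\<close>.\<close>

lemma pair_pi_duality_if_pair_pi_annihilator:
  fixes Y :: "'a::real_normed_vector set"
  assumes Y: "subspace Y" and lam: "lam \<ge> 1" and mu: "mu \<ge> 1"
    and pi: "pair_pi lam (annihilator Y)" and bap: "pair_bap mu Y"
  shows "pair_pi_duality (lam * mu + lam + mu) Y"
  unfolding pair_pi_duality_def
proof (intro allI impI)
  fix E :: "'a set" and F :: "('a \<Rightarrow>\<^sub>L real) set" and \<epsilon> :: real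
  assume E: "fin_dim_subspace E" and F: "fin_dim_subspace F" and "\<epsilon> > 0"
  obtain d where d: "d > 0" "\<And>a b. 0 \<le> b \<Longrightarrow> a \<le> lam + d \<Longrightarrow> b \<le> mu + d \<Longrightarrow>
      a + b + a * b \<le> lam * mu + lam + mu + \<epsilon>"
    using ex_norm_slack[OF lam mu \<open>\<epsilon> > 0\<close>] by metis
  obtain T :: "'a \<Rightarrow>\<^sub>L 'a" where T: "finite_rank T" "T ` Y \<subseteq> Y" "norm T \<le> mu + d"
    "\<And>x. x \<in> E \<Longrightarrow> T x = x"
    using bap E d(1) unfolding pair_bap_def by meson
  obtain D where D: "finite D" "\<And>f :: 'a \<Rightarrow>\<^sub>L real. f o\<^sub>L T \<in> span D"
    using finite_rank_adjoint[OF T(1)] by metis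
  obtain B where B: "finite B" "F = span B"
    using F by (auto simp: fin_dim_subspace_def)
  have "fin_dim_subspace (span (B \<union> D))"
    using B(1) D(1) by (auto simp: fin_dim_subspace_def)
  moreover have "d / 2 > 0"
    using d(1) by simp
  ultimately obtain R where R: "finite_rank R" "R o\<^sub>L R = R" "R ` annihilator Y \<subseteq> annihilator Y"
    "norm R \<le> lam + d / 2" "\<And>f. f \<in> span (B \<union> D) \<Longrightarrow> R f = f"
    using pi unfolding pair_pi_def by meson
  obtain C where C: "finite C" "range R = span C"
    using finite_rank_range_eq_span[OF R(1)] by metis
  have R_span: "R g = g" if g: "g \<in> span C" for g
  proof -
    obtain h where "g = R h"
      using C(2) g by auto
    then show ?thesis
      using R(2) by (metis blinfun_apply_blinfun_compose)
  qed
  obtain Q :: "'a \<Rightarrow>\<^sub>L 'a" where Q: "finite_rank Q" "Q ` Y \<subseteq> Y" "norm Q \<le> norm R + d / 2"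
    "\<And>g. g \<in> C \<Longrightarrow> g o\<^sub>L Q = g" "\<And>f. f o\<^sub>L Q \<in> span C"
    using local_reflexivity_pair[of Y C R C "d / 2"] Y C R(3) d(1) R_span
    by (metis half_gt_zero order_refl span_base)
  have Q_span: "g o\<^sub>L Q = g" if "g \<in> span C" for g
    using Q(4) that by (rule compose_eq_on_span)
  have "span (B \<union> D) \<subseteq> span C"
    using R(5) C(2) by (metis rangeI subsetI)
  then have BD: "span B \<subseteq> span C" "span D \<subseteq> span C"
    using span_mono[of B "B \<union> D"] span_mono[of D "B \<union> D"] by auto
  \<comment> \<open>\<open>Q\<close> is known through its adjoint, so operator identities are tested
    with functionals, which separate points.\<close>
  have Q_idem: "Q o\<^sub>L Q = Q"
  proof (rule blinfun_eqI, rule ccontr)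
    fix x
    assume "(Q o\<^sub>L Q) x \<noteq> Q x"
    then obtain f :: "'a \<Rightarrow>\<^sub>L real" where "f (Q (Q x) - Q x) \<noteq> 0"
      using ex_blinfun_apply_nonzero[of "Q (Q x) - Q x"] by auto
    moreover have "((f o\<^sub>L Q) o\<^sub>L Q) x = (f o\<^sub>L Q) x"
      using Q_span[OF Q(5)] by simp
    ultimately show False
      by (simp add: blinfun.diff_right)
  qed
  have TQ: "T o\<^sub>L Q = T"
  proof (rule blinfun_eqI, rule ccontr)
    fix x
    assume "(T o\<^sub>L Q) x \<noteq> T x"
    then obtain f :: "'a \<Rightarrow>\<^sub>L real" where "f (T (Q x) - T x) \<noteq> 0"
      using ex_blinfun_apply_nonzero[of "T (Q x) - T x"] by auto
    moreover have "((f o\<^sub>L T) o\<^sub>L Q) x = (f o\<^sub>L T) x"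
      using Q_span[OF subsetD[OF BD(2) D(2)]] by simp
    ultimately show False
      by (simp add: blinfun.diff_right)
  qed
  have "norm Q \<le> lam + d"
    using Q(3) R(4) by simp
  then have "norm (circle_sum Q T) \<le> lam * mu + lam + mu + \<epsilon>"
    using norm_circle_sum[of Q T] d(2)[of "norm T" "norm Q"] T(3) by (simp add: algebra_simps)
  moreover have "\<forall>f\<in>F. f o\<^sub>L circle_sum Q T = f"
    using Q_span BD B(2) by (auto intro!: compose_circle_sum)
  ultimately show "\<exists>P. finite_rank P \<and> P o\<^sub>L P = P \<and> P ` Y \<subseteq> Y \<and>
      norm P \<le> lam * mu + lam + mu + \<epsilon> \<and> (\<forall>z\<in>E. P z = z) \<and> (\<forall>f\<in>F. f o\<^sub>L P = f)"
    using circle_sum_idempotent_left[OF Q_idem TQ] finite_rank_circle_sum[OF Q(1) T(1)]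
      circle_sum_image_subset[OF Y Q(2) T(2)] T(4) circle_sum_fixes[of T]
    by (intro exI[of _ "circle_sum Q T"]) simp
qed

text \<open>The dual operator \<open>S\<close> is first replaced by \<open>T\<close>, whose adjoint
  fixes \<open>F\<close>; the projection \<open>Q\<close> is chosen last to fix both
  \<open>E\<close> and the range of \<open>T\<close>, so that
  \<open>Q o\<^sub>L T = T\<close>.\<close>

lemma pair_pi_duality_if_pair_bap_annihilator:
  fixes Y :: "'a::real_normed_vector set"
  assumes Y: "subspace Y" and lam: "lam \<ge> 1" and mu: "mu \<ge> 1"
    and pi: "pair_pi lam Y" and bap: "pair_bap mu (annihilator Y)"
  shows "pair_pi_duality (lam * mu + lam + mu) Y"
  unfolding pair_pi_duality_def
proof (intro allI impI)
  fix E :: "'a set" and F :: "('a \<Rightarrow>\<^sub>L real) set" and \<epsilon> :: real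
  assume E: "fin_dim_subspace E" and F: "fin_dim_subspace F" and "\<epsilon> > 0"
  obtain d where d: "d > 0" "\<And>a b. 0 \<le> b \<Longrightarrow> a \<le> lam + d \<Longrightarrow> b \<le> mu + d \<Longrightarrow>
      a + b + a * b \<le> lam * mu + lam + mu + \<epsilon>"
    using ex_norm_slack[OF lam mu \<open>\<epsilon> > 0\<close>] by metis
  have d2: "d / 2 > 0"
    using d(1) by simp
  obtain A where A: "finite A" "E = span A"
    using E by (auto simp: fin_dim_subspace_def)
  obtain C where C: "finite C" "F = span C"
    using F by (auto simp: fin_dim_subspace_def)
  obtain S where S: "finite_rank S" "S ` annihilator Y \<subseteq> annihilator Y"
    "norm S \<le> mu + d / 2" "\<And>f. f \<in> F \<Longrightarrow> S f = f"
    using bap F d2 unfolding pair_bap_def by meson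
  obtain B where B: "finite B" "range S \<subseteq> span B"
    using S(1) by (auto simp: finite_rank_def)
  obtain T :: "'a \<Rightarrow>\<^sub>L 'a" where T: "finite_rank T" "T ` Y \<subseteq> Y" "norm T \<le> norm S + d / 2"
    "\<And>g. g \<in> C \<Longrightarrow> g o\<^sub>L T = g"
    using local_reflexivity_pair[OF Y B C(1) _ S(2) d2] S(4) C(2) by (metis span_base)
  have T_F: "g o\<^sub>L T = g" if "g \<in> F" for g
    using T(4) that unfolding C(2) by (rule compose_eq_on_span)
  obtain D where D: "finite D" "range T \<subseteq> span D"
    using T(1) by (auto simp: finite_rank_def)
  have "fin_dim_subspace (span (A \<union> D))"
    using A(1) D(1) by (auto simp: fin_dim_subspace_def)
  then obtain Q :: "'a \<Rightarrow>\<^sub>L 'a" where Q: "finite_rank Q" "Q o\<^sub>L Q = Q" "Q ` Y \<subseteq> Y"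
    "norm Q \<le> lam + d" "\<And>x. x \<in> span (A \<union> D) \<Longrightarrow> Q x = x"
    using pi d(1) unfolding pair_pi_def by meson
  have AD: "span A \<subseteq> span (A \<union> D)" "span D \<subseteq> span (A \<union> D)"
    by (auto intro!: span_mono)
  have QT: "Q o\<^sub>L T = T"
    using Q(5) D(2) AD by (intro blinfun_eqI) auto
  have "norm T \<le> mu + d"
    using T(3) S(3) by simp
  then have "norm (circle_sum T Q) \<le> lam * mu + lam + mu + \<epsilon>"
    using norm_circle_sum[of T Q] d(2)[of "norm T" "norm Q"] Q(4) by (simp add: algebra_simps)
  moreover have "\<forall>z\<in>E. circle_sum T Q z = z"
    using Q(5) AD A(2) by (auto intro!: circle_sum_fixes)
  ultimately show "\<exists>P. finite_rank P \<and> P o\<^sub>L P = P \<and> P ` Y \<subseteq> Y \<and>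
      norm P \<le> lam * mu + lam + mu + \<epsilon> \<and> (\<forall>z\<in>E. P z = z) \<and> (\<forall>f\<in>F. f o\<^sub>L P = f)"
    using circle_sum_idempotent_right[OF Q(2) QT] finite_rank_circle_sum[OF T(1) Q(1)]
      circle_sum_image_subset[OF Y T(2) Q(3)] compose_circle_sum[OF T_F]
    by (intro exI[of _ "circle_sum T Q"]) simp
qed

theorem theorem4p4:
  fixes Y :: "'a::banach set" and lam mu :: real
  assumes "subspace Y" and "closed Y" and "lam \<ge> 1" and "mu \<ge> 1"
  shows "(pair_pi lam (annihilator Y) \<and> pair_bap mu Y
            \<longrightarrow> pair_pi_duality (lam * mu + lam + mu) Y)
       \<and> (pair_pi lam Y \<and> pair_bap mu (annihilator Y)
            \<longrightarrow> pair_pi_duality (lam * mu + lam + mu) Y)"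
  using assms pair_pi_duality_if_pair_pi_annihilator pair_pi_duality_if_pair_bap_annihilator
  by blast

end
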